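(* The radii of the classes $\mathcal{G}_1,\mathcal{G}_2,\mathcal{G}_3$ with respect to the class $\mathcal{S}_{Ne}^*$ (starlike functions associated with a nephroid) are exactly: (i) $R_{\mathcal{S}_{Ne}^{*}}(\mathcal{G}_1)= (\sqrt{85}-9)/2\approx 0.1097$; (ii) $R_{\mathcal{S}_{Ne}^{*}}(\mathcal{G}_2)= (\sqrt{265}-15)/10\approx 0.1278$; (iii) $R_{\mathcal{S}_{Ne}^{*}}(\mathcal{G}_3)= \sqrt{10}-3\approx 0.1622$.
   Context: $\mathbb{D}$ is the open unit disc in $\mathbb{C}$. $\mathcal{A}$ is the class of analytic functions $f$ on $\mathbb{D}$ with $f(0)=0$, $f'(0)=1$. $\mathcal{P}$ is the class of analytic functions $p$ on $\mathbb{D}$ with $p(0)=1$ and $\operatorname{Re}p(z)>0$ for all $z\in\mathbb{D}$; $\mathcal{P}(1/2)=\{p\in\mathcal{P}:\operatorname{Re}p(z)>1/2 \text{ for all } z\in\mathbb{D}\}$. Quotients below are understood with removable singularities filled in (in particular at $0$). Define $\mathcal{G}_1=\{f\in\mathcal{A}: f/g\in\mathcal{P}\text{ and } g/(zp)\in\mathcal{P}\text{ for some } g\in\mathcal{A},\ p\in\mathcal{P}\}$, $\mathcal{G}_2=\{f\in\mathcal{A}: f/g\in\mathcal{P}\text{ and } g/(zp)\in\mathcal{P}(1/2)\text{ for some } g\in\mathcal{A},\ p\in\mathcal{P}\}$, $\mathcal{G}_3=\{f\in\mathcal{A}: f/(zp)\in\mathcal{P}\text{ for some } p\in\mathcal{P}\}$.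 For subclasses $\mathcal{F},\mathcal{G}$ of $\mathcal{A}$, the $\mathcal{G}$-radius $R_{\mathcal{G}}(\mathcal{F})$ of $\mathcal{F}$ is the largest number $R\in(0,1)$ such that, for every $f\in\mathcal{F}$ and every $0<r<R$, the function $z\mapsto r^{-1}f(rz)$ belongs to $\mathcal{G}$. For analytic $f,g$ on $\mathbb{D}$, $f\prec g$ ($f$ is subordinate to $g$) means $f=g\circ w$ for some analytic $w:\mathbb{D}\to\mathbb{D}$ with $w(0)=0$. For an analytic univalent $\varphi$ on $\mathbb{D}$ with $\varphi(0)=1$, $\mathcal{S}^*(\varphi)=\{f\in\mathcal{A}: zf'(z)/f(z)\prec\varphi(z)\}$. $\mathcal{S}_{Ne}^*=\mathcal{S}^*\left(1+z-\tfrac{z^3}{3}\right)$. *)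

theory Defs
  imports "HOL-Complex_Analysis.Complex_Analysis"
begin

text \<open>
  Functions on the unit disc are total functions of type \<open>complex \<Rightarrow> complex\<close>; every notion
  below depends only on their values on \<open>ball 0 1\<close>. Quotients are wrapped in
  \<open>remove_sings\<close>, which takes the limit wherever it exists. At a pole it returns 0 (as
  Isabelle's division does at a zero of the denominator), so holomorphy of the result is
  always required separately.
\<close>

abbreviation unit_disc :: "complex set" ("\<D>")
  where "\<D> \<equiv> ball 0 1"

definition class_A :: "(complex \<Rightarrow> complex) set" ("\<A>")
  where "\<A> = {f. f holomorphic_on \<D> \<and> f 0 = 0 \<and> deriv f 0 = 1}"

definition class_P :: "(complex \<Rightarrow> complex) set" ("\<P>")
  where "\<P> = {p. p holomorphic_on \<D> \<and> p 0 = 1 \<and> (\<forall>z\<in>\<D>. Re (p z) > 0)}"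

definition class_P_half :: "(complex \<Rightarrow> complex) set" ("\<P>\<^bsub>1'/2\<^esub>")
  where "\<P>\<^bsub>1/2\<^esub> = {p \<in> \<P>. \<forall>z\<in>\<D>. Re (p z) > 1 / 2}"

definition class_G1 :: "(complex \<Rightarrow> complex) set" ("\<G>\<^sub>1")
  where "\<G>\<^sub>1 = {f \<in> \<A>. \<exists>g\<in>\<A>. \<exists>p\<in>\<P>.
    remove_sings (\<lambda>z. f z / g z) \<in> \<P> \<and> remove_sings (\<lambda>z. g z / (z * p z)) \<in> \<P>}"

definition class_G2 :: "(complex \<Rightarrow> complex) set" ("\<G>\<^sub>2")
  where "\<G>\<^sub>2 = {f \<in> \<A>. \<exists>g\<in>\<A>. \<exists>p\<in>\<P>.
    remove_sings (\<lambda>z. f z / g z) \<in> \<P> \<and> remove_sings (\<lambda>z. g z / (z * p z)) \<in> \<P>\<^bsub>1/2\<^esub>}"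

definition class_G3 :: "(complex \<Rightarrow> complex) set" ("\<G>\<^sub>3")
  where "\<G>\<^sub>3 = {f \<in> \<A>. \<exists>p\<in>\<P>. remove_sings (\<lambda>z. f z / (z * p z)) \<in> \<P>}"

definition subordinate :: "(complex \<Rightarrow> complex) \<Rightarrow> (complex \<Rightarrow> complex) \<Rightarrow> bool" (infix "\<prec>" 50)
  where "f \<prec> g \<longleftrightarrow> f holomorphic_on \<D> \<and> g holomorphic_on \<D> \<and>
    (\<exists>w. w holomorphic_on \<D> \<and> w ` \<D> \<subseteq> \<D> \<and> w 0 = 0 \<and> (\<forall>z\<in>\<D>. f z = g (w z)))"

text \<open>
  \<open>starlike_class \<phi>\<close> is meant for univalent \<open>\<phi>\<close> with \<open>\<phi> 0 = 1\<close>; the lemma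
  \<open>nephroid_admissible\<close> shows that the nephroid function is of this kind.
\<close>

definition starlike_class :: "(complex \<Rightarrow> complex) \<Rightarrow> (complex \<Rightarrow> complex) set" ("\<S>\<^sup>*")
  where "\<S>\<^sup>* \<phi> = {f \<in> \<A>. remove_sings (\<lambda>z. z * deriv f z / f z) \<prec> \<phi>}"

definition nephroid :: "complex \<Rightarrow> complex"
  where "nephroid z = 1 + z - z ^ 3 / 3"

lemma nephroid_admissible:
  "nephroid holomorphic_on \<D>" "inj_on nephroid \<D>" "nephroid 0 = 1"
proof -
  show "nephroid holomorphic_on \<D>"
    unfolding nephroid_def by (intro holomorphic_intros) auto
  show "nephroid 0 = 1"
    by (simp add: nephroid_def)
  show "inj_on nephroid \<D>"
  proof (rule inj_onI, rule ccontr)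
    fix z w :: complex
    assume z: "z \<in> \<D>" and w: "w \<in> \<D>" and eq: "nephroid z = nephroid w" and "z \<noteq> w"
    have "(z - w) * (3 - (z\<^sup>2 + z * w + w\<^sup>2)) = 3 * (nephroid z - nephroid w)"
      by (simp add: nephroid_def field_simps power2_eq_square power3_eq_cube)
    with eq \<open>z \<noteq> w\<close> have *: "z\<^sup>2 + z * w + w\<^sup>2 = 3"
      by simp
    have zw: "norm z < 1" "norm w < 1"
      using z w by auto
    have "norm (z\<^sup>2) < 1" "norm (w\<^sup>2) < 1"
      using zw by (simp_all add: norm_power power_less_one_iff)
    moreover have "norm (z * w) < 1"
      using mult_strict_mono'[OF zw] by (simp add: norm_mult)
    ultimately have "norm (z\<^sup>2 + z * w + w\<^sup>2) < 3"
      using norm_triangle_ineq[of "z\<^sup>2 + z * w" "w\<^sup>2"] norm_triangle_ineq[of "z\<^sup>2" "z * w"]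
      by linarith
    with * show False
      by simp
  qed
qed

definition starlike_Ne :: "(complex \<Rightarrow> complex) set" ("\<S>\<^sup>*\<^sub>N\<^sub>e")
  where "\<S>\<^sup>*\<^sub>N\<^sub>e = \<S>\<^sup>* nephroid"

definition has_radius_property ::
    "(complex \<Rightarrow> complex) set \<Rightarrow> (complex \<Rightarrow> complex) set \<Rightarrow> real \<Rightarrow> bool"
  where "has_radius_property G F R \<longleftrightarrow> R \<in> {0<..<1} \<and>
    (\<forall>f\<in>F. \<forall>r. 0 < r \<and> r < R \<longrightarrow>
      (\<lambda>z. inverse (complex_of_real r) * f (complex_of_real r * z)) \<in> G)"

text \<open>
  \<open>is_radius G F R\<close> says that the \<open>G\<close>-radius of \<open>F\<close> exists and equals \<open>R\<close>.
\<close>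

definition is_radius ::
    "(complex \<Rightarrow> complex) set \<Rightarrow> (complex \<Rightarrow> complex) set \<Rightarrow> real \<Rightarrow> bool"
  where "is_radius G F R \<longleftrightarrow>
    has_radius_property G F R \<and> (\<forall>R'. has_radius_property G F R' \<longrightarrow> R' \<le> R)"

end

theory Submission
  imports Defs
begin

text \<open>
  A function \<open>f\<close> lies in one of the three classes exactly when \<open>f z = z * h z\<close> on the disc, where
  \<open>h\<close> is a product of functions with positive real part: three for \<open>\<G>\<^sub>1\<close>, two for \<open>\<G>\<^sub>3\<close>, and for
  \<open>\<G>\<^sub>2\<close> two of them times one whose real part exceeds \<open>1 / 2\<close> (\<open>class_G1_iff\<close>, \<open>class_G2_iff\<close>,
  \<open>class_G3_iff\<close>). Then \<open>z f' / f = 1 + z h' / h\<close>, and \<open>z h' / h\<close> is the sum of the corresponding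
  terms of the factors. On the circle of radius \<open>t\<close> each term is bounded by the Schwarz--Pick
  inequality: by \<open>2 t / (1 - t\<^sup>2)\<close> for a function in \<open>\<P>\<close> and by \<open>t / (1 - t)\<close> for real part above
  \<open>1 / 2\<close> (\<open>norm_log_rate_class_P\<close>, \<open>norm_log_rate_class_P_half\<close>).

  The nephroid domain contains the disc of radius \<open>2 / 3\<close> about \<open>1\<close>, because
  \<open>\<bar>z - z ^ 3 / 3\<bar> \<ge> 2 / 3\<close> on the unit circle. By univalence a holomorphic \<open>F\<close> with \<open>F 0 = 1\<close> and
  values in that disc is subordinate to \<open>nephroid\<close>. So the dilation of \<open>f\<close> by \<open>r\<close> is in the
  nephroid class as long as the sum of the bounds at \<open>r\<close> stays below \<open>2 / 3\<close>, and each of the three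
  radii is the positive root of the quadratic equation that says that this sum equals \<open>2 / 3\<close>.

  The radii are sharp since the bounds are attained simultaneously at positive real points, by
  \<open>(1 + z) / (1 - z)\<close> and \<open>1 / (1 - z)\<close>. For \<open>f\<close> built from these factors, \<open>z f' / f\<close> takes the
  value \<open>5 / 3\<close> at the radius. This is the image of the boundary point \<open>1\<close> and is not a value of
  \<open>nephroid\<close> inside the disc, so no larger dilation can be subordinate (\<open>is_radius_starlike_Ne\<close>).
\<close>

section \<open>The Schwarz--Pick inequality\<close>

lemma Moebius_denominator_nonzero:
  fixes a z :: complex
  assumes "norm a < 1" "norm z < 1"
  shows "1 - cnj a * z \<noteq> 0"
proof
  assume "1 - cnj a * z = 0"
  then have "norm (cnj a * z) = 1"
    by simp
  moreover have "norm (cnj a * z) < 1"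
    using mult_strict_mono'[OF assms] by (simp add: norm_mult)
  ultimately show False
    by simp
qed

lemma Moebius_function_has_derivative:
  assumes "norm a < 1" "norm z < 1"
  shows "(Moebius_function 0 a has_field_derivative
           of_real (1 - (norm a)\<^sup>2) / (1 - cnj a * z)\<^sup>2) (at z)"
proof -
  have ne: "1 - cnj a * z \<noteq> 0"
    using Moebius_denominator_nonzero[OF assms] .
  have na: "of_real (1 - (norm a)\<^sup>2) = 1 - cnj a * a"
    using complex_norm_square[of a] by (simp add: mult.commute)
  have "((\<lambda>z. (z - a) / (1 - cnj a * z)) has_field_derivative
          of_real (1 - (norm a)\<^sup>2) / (1 - cnj a * z)\<^sup>2) (at z)"
    unfolding na
    by (rule derivative_eq_intros refl ne)+ (simp add: power2_eq_square algebra_simps)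
  then show ?thesis
    by (simp add: Moebius_function_simple[abs_def])
qed

text \<open>
  Disc automorphisms that move \<open>a\<close> and \<open>w a\<close> to the origin reduce the inequality to the bound
  \<open>\<bar>g' 0\<bar> \<le> 1\<close> of the Schwarz lemma; the right-hand side is the inverse of the product of the
  derivatives of the two automorphisms.
\<close>

lemma Schwarz_Pick_deriv:
  fixes w :: "complex \<Rightarrow> complex"
  assumes hol: "w holomorphic_on \<D>" and less: "\<And>z. z \<in> \<D> \<Longrightarrow> norm (w z) < 1"
    and a: "a \<in> \<D>"
  shows "norm (deriv w a) \<le> (1 - (norm (w a))\<^sup>2) / (1 - (norm a)\<^sup>2)"
proof -
  have na: "norm a < 1" "norm (-a) < 1" and nw: "norm (w a) < 1"
    using a less[OF a] by auto
  define g where "g = Moebius_function 0 (w a) \<circ> (w \<circ> Moebius_function 0 (-a))"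
  have M0: "Moebius_function 0 (-a) 0 = a"
    by (simp add: Moebius_function_simple)
  have maps: "Moebius_function 0 (-a) ` \<D> \<subseteq> \<D>" "(w \<circ> Moebius_function 0 (-a)) ` \<D> \<subseteq> \<D>"
    using Moebius_function_norm_lt_1[OF na(2)] less by auto
  have "g holomorphic_on \<D>"
    unfolding g_def
    using maps hol na(2) nw
    by (intro holomorphic_on_compose_gen[where t = \<D>] Moebius_function_holomorphic) auto
  moreover have "g 0 = 0"
    by (simp add: g_def M0 Moebius_function_eq_zero)
  moreover have "norm (g z) < 1" if "norm z < 1" for z
    using Moebius_function_norm_lt_1[OF nw] less Moebius_function_norm_lt_1[OF na(2) that]
    by (simp add: g_def)
  ultimately have g': "norm (deriv g 0) \<le> 1"
    using Schwarz_Lemma(2)[of g 0] by simp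
  have d1: "(Moebius_function 0 (-a) has_field_derivative of_real (1 - (norm a)\<^sup>2)) (at 0)"
    using Moebius_function_has_derivative[OF na(2), of 0] by simp
  have d2: "(w has_field_derivative deriv w a) (at (Moebius_function 0 (-a) 0))"
    unfolding M0 using holomorphic_derivI[OF hol open_ball a] .
  have d3: "(Moebius_function 0 (w a) has_field_derivative
      of_real (1 - (norm (w a))\<^sup>2) / (1 - cnj (w a) * w a)\<^sup>2)
      (at ((w \<circ> Moebius_function 0 (-a)) 0))"
    using Moebius_function_has_derivative[OF nw nw] by (simp add: M0)
  have pos: "0 < 1 - (norm (w a))\<^sup>2" "0 < 1 - (norm a)\<^sup>2"
    using nw na by (simp_all add: power_less_one_iff abs_square_less_1)
  have sq: "1 - cnj (w a) * w a = of_real (1 - (norm (w a))\<^sup>2)"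
    using complex_norm_square[of "w a"] by (simp add: mult.commute)
  have "deriv g 0 = of_real (1 - (norm (w a))\<^sup>2) / (1 - cnj (w a) * w a)\<^sup>2
      * (deriv w a * of_real (1 - (norm a)\<^sup>2))"
    unfolding g_def by (intro DERIV_imp_deriv DERIV_chain d1 d2 d3)
  also have "\<dots> = deriv w a * of_real ((1 - (norm a)\<^sup>2) / (1 - (norm (w a))\<^sup>2))"
    unfolding sq using pos by (simp add: power2_eq_square del: of_real_diff)
  finally have "norm (deriv g 0) =
      norm (deriv w a) * ((1 - (norm a)\<^sup>2) / (1 - (norm (w a))\<^sup>2))"
    using pos by (simp add: norm_mult norm_divide del: of_real_diff of_real_divide)
  with g' pos show ?thesis
    by (simp add: field_simps)
qed

section \<open>Growth of logarithmic derivatives\<close>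

text \<open>
  The functions \<open>f z / z\<close>, for \<open>f\<close> in \<open>\<A>\<close> without zeros outside the origin. The normalization at
  \<open>0\<close> is part of the notion, so that it corresponds to \<open>deriv f 0 = 1\<close>.
\<close>

definition nonvanishing :: "(complex \<Rightarrow> complex) \<Rightarrow> bool"
  where "nonvanishing h \<longleftrightarrow> h holomorphic_on \<D> \<and> h 0 = 1 \<and> (\<forall>z\<in>\<D>. h z \<noteq> 0)"

text \<open>
  If \<open>f z = z * h z\<close>, then \<open>z f' / f\<close> equals \<open>1 + log_rate h\<close>, without a singularity at the origin.
\<close>

definition log_rate :: "(complex \<Rightarrow> complex) \<Rightarrow> complex \<Rightarrow> complex"
  where "log_rate h z = z * deriv h z / h z"

lemma nonvanishing_mult:
  "nonvanishing h \<Longrightarrow> nonvanishing k \<Longrightarrow> nonvanishing (\<lambda>z. h z * k z)"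
  by (auto simp: nonvanishing_def intro: holomorphic_intros)

lemma nonvanishing_class_P: "p \<in> \<P> \<Longrightarrow> nonvanishing p"
  by (force simp: nonvanishing_def class_P_def)

lemma class_P_half_subset: "p \<in> \<P>\<^bsub>1/2\<^esub> \<Longrightarrow> p \<in> \<P>"
  by (simp add: class_P_half_def)

lemma log_rate_mult:
  assumes "nonvanishing h" "nonvanishing k" "z \<in> \<D>"
  shows "log_rate (\<lambda>z. h z * k z) z = log_rate h z + log_rate k z"
proof -
  have "h field_differentiable at z" "k field_differentiable at z"
    using assms holomorphic_on_imp_differentiable_at[OF _ open_ball]
    by (auto simp: nonvanishing_def)
  moreover have "h z \<noteq> 0" "k z \<noteq> 0"
    using assms by (auto simp: nonvanishing_def)
  ultimately show ?thesis
    by (simp add: log_rate_def field_simps)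
qed

text \<open>
  The Cayley transform \<open>w = (p - 1) / (p + 1)\<close> maps the disc into itself, and
  \<open>p' / p = 2 w' / (1 - w\<^sup>2)\<close>. Since \<open>1 - \<bar>w\<bar>\<^sup>2 \<le> \<bar>1 - w\<^sup>2\<bar>\<close>, the Schwarz--Pick bound for \<open>w'\<close> cancels
  the denominator.
\<close>

lemma norm_log_rate_class_P:
  assumes p: "p \<in> \<P>" and z: "z \<in> \<D>"
  shows "norm (log_rate p z) \<le> 2 * norm z / (1 - (norm z)\<^sup>2)"
proof -
  define w where "w = (\<lambda>z. (p z - 1) / (p z + 1))"
  have hol: "p holomorphic_on \<D>" and pos: "\<And>z. z \<in> \<D> \<Longrightarrow> 0 < Re (p z)"
    using p by (auto simp: class_P_def)
  have ne: "p z + 1 \<noteq> 0" if "z \<in> \<D>" for z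
    using pos[OF that] by (auto simp: complex_eq_iff)
  have holw: "w holomorphic_on \<D>"
    unfolding w_def using hol ne by (intro holomorphic_intros) auto
  have less: "norm (w z) < 1" if "z \<in> \<D>" for z
  proof -
    have "(norm (p z - 1))\<^sup>2 < (norm (p z + 1))\<^sup>2"
      using pos[OF that] by (simp add: cmod_power2) (simp add: power2_eq_square algebra_simps)
    then have "norm (p z - 1) < norm (p z + 1)"
      by (simp add: power_less_imp_less_base)
    then show ?thesis
      using ne[OF that] by (simp add: w_def norm_divide)
  qed
  have dp: "(p has_field_derivative deriv p z) (at z)"
    using holomorphic_derivI[OF hol open_ball z] .
  have "(w has_field_derivative 2 * deriv p z / (p z + 1)\<^sup>2) (at z)"
    unfolding w_def
    by (rule derivative_eq_intros dp refl ne[OF z] | simp)+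
       (simp add: power2_eq_square algebra_simps)
  then have dw: "deriv w z = 2 * deriv p z / (p z + 1)\<^sup>2"
    by (rule DERIV_imp_deriv)
  have p0: "p z \<noteq> 0"
    using pos[OF z] by auto
  have quot: "1 - (w z)\<^sup>2 = 4 * p z / (p z + 1)\<^sup>2"
  proof -
    have "1 - (w z)\<^sup>2 = ((p z + 1)\<^sup>2 - (p z - 1)\<^sup>2) / (p z + 1)\<^sup>2"
      using ne[OF z] by (simp add: w_def power_divide) (simp add: diff_divide_distrib)
    also have "(p z + 1)\<^sup>2 - (p z - 1)\<^sup>2 = 4 * p z"
      by (simp add: power2_eq_square algebra_simps)
    finally show ?thesis .
  qed
  have w0: "1 - (w z)\<^sup>2 \<noteq> 0"
    unfolding quot using ne[OF z] p0 by simp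
  have rate: "log_rate p z = 2 * z * deriv w z / (1 - (w z)\<^sup>2)"
    unfolding quot dw log_rate_def using ne[OF z] p0 by (simp add: field_simps)
  have gap: "1 - (norm (w z))\<^sup>2 \<le> norm (1 - (w z)\<^sup>2)"
    using norm_triangle_ineq2[of 1 "(w z)\<^sup>2"] by (simp add: norm_power)
  have "norm (deriv w z) \<le> (1 - (norm (w z))\<^sup>2) / (1 - (norm z)\<^sup>2)"
    using Schwarz_Pick_deriv[OF holw less z] .
  also have "\<dots> \<le> norm (1 - (w z)\<^sup>2) / (1 - (norm z)\<^sup>2)"
    using gap z by (intro divide_right_mono) (auto simp: power_le_one)
  finally have "norm (deriv w z) / norm (1 - (w z)\<^sup>2) \<le> 1 / (1 - (norm z)\<^sup>2)"
    using w0 by (simp add: field_simps)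
  then have "2 * norm z * (norm (deriv w z) / norm (1 - (w z)\<^sup>2)) \<le>
      2 * norm z * (1 / (1 - (norm z)\<^sup>2))"
    by (intro mult_left_mono) auto
  then show ?thesis
    unfolding rate by (simp add: norm_mult norm_divide)
qed

text \<open>
  Inversion maps the half plane of real part above \<open>1 / 2\<close> to the unit disc about \<open>1\<close>, so
  \<open>w = 1 / q - 1\<close> is a self-map of the disc with \<open>w 0 = 0\<close>, and \<open>q' / q = - w' / (1 + w)\<close>.
  Schwarz--Pick leaves the factor \<open>1 + \<bar>w z\<bar>\<close>, and the Schwarz lemma bounds it by \<open>1 + \<bar>z\<bar>\<close>.
\<close>

lemma norm_log_rate_class_P_half:
  assumes q: "q \<in> \<P>\<^bsub>1/2\<^esub>" and z: "z \<in> \<D>"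
  shows "norm (log_rate q z) \<le> norm z / (1 - norm z)"
proof -
  define w where "w = (\<lambda>z. 1 / q z - 1)"
  have hol: "q holomorphic_on \<D>" and q1: "q 0 = 1"
    and half: "\<And>z. z \<in> \<D> \<Longrightarrow> 1 / 2 < Re (q z)"
    using q by (auto simp: class_P_half_def class_P_def)
  have ne: "q z \<noteq> 0" if "z \<in> \<D>" for z
    using half[OF that] by auto
  have holw: "w holomorphic_on \<D>"
    unfolding w_def using hol ne by (intro holomorphic_intros) auto
  have less: "norm (w z) < 1" if "z \<in> \<D>" for z
  proof -
    have "(norm (1 - q z))\<^sup>2 < (norm (q z))\<^sup>2"
      using half[OF that] by (simp add: cmod_power2) (simp add: power2_eq_square algebra_simps)
    then have "norm (1 - q z) < norm (q z)"
      by (simp add: power_less_imp_less_base)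
    moreover have "w z = (1 - q z) / q z"
      using ne[OF that] by (simp add: w_def field_simps)
    ultimately show ?thesis
      using ne[OF that] by (simp add: norm_divide)
  qed
  have w00: "w 0 = 0"
    by (simp add: w_def q1)
  have schwarz: "norm (w z) \<le> norm z"
    using Schwarz_Lemma(1)[OF holw w00, of z] less z by auto
  have dq: "(q has_field_derivative deriv q z) (at z)"
    using holomorphic_derivI[OF hol open_ball z] .
  have "(w has_field_derivative - deriv q z / (q z)\<^sup>2) (at z)"
    unfolding w_def
    by (rule derivative_eq_intros dq refl ne[OF z] | simp add: power2_eq_square)+
  then have dw: "deriv w z = - deriv q z / (q z)\<^sup>2"
    by (rule DERIV_imp_deriv)
  have rate: "log_rate q z = - (z * deriv w z / (1 + w z))"
  proof -
    have "1 + w z = 1 / q z"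
      by (simp add: w_def)
    then show ?thesis
      unfolding dw log_rate_def using ne[OF z] by (simp add: power2_eq_square)
  qed
  define s t where "s = norm (w z)" and "t = norm z"
  have st: "0 \<le> s" "s < 1" "s \<le> t" "0 \<le> t" "t < 1"
    using less[OF z] schwarz z by (auto simp: s_def t_def)
  have t2: "0 < 1 - t\<^sup>2"
    using st by (simp add: abs_square_less_1)
  have den: "1 - s \<le> norm (1 + w z)"
    using norm_triangle_ineq2[of 1 "- w z"] by (simp add: s_def)
  have "0 \<le> 1 - s\<^sup>2"
    using st by (simp add: power_le_one)
  then have nonneg: "0 \<le> (1 - s\<^sup>2) / (1 - t\<^sup>2)"
    using t2 by simp
  have "norm (log_rate q z) = t * norm (deriv w z) / norm (1 + w z)"
    unfolding rate by (simp add: norm_mult norm_divide t_def)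
  also have "\<dots> \<le> t * ((1 - s\<^sup>2) / (1 - t\<^sup>2)) / (1 - s)"
    using Schwarz_Pick_deriv[OF holw less z, folded s_def t_def] den st nonneg
    by (intro frac_le mult_left_mono mult_nonneg_nonneg) auto
  also have "\<dots> = t * (1 + s) / (1 - t\<^sup>2)"
    using st t2 by (simp add: divide_simps) (simp add: power2_eq_square algebra_simps)
  also have "\<dots> \<le> t * (1 + t) / (1 - t\<^sup>2)"
    using st t2 by (intro divide_right_mono mult_left_mono) auto
  also have "\<dots> = t / (1 - t)"
    using st t2 by (simp add: divide_simps) (simp add: power2_eq_square algebra_simps)
  finally show ?thesis
    by (simp add: t_def)
qed

section \<open>Product representations of the classes\<close>

lemma remove_sings_eq_off_0:
  assumes "q holomorphic_on \<D>" "\<And>z. z \<in> \<D> \<Longrightarrow> z \<noteq> 0 \<Longrightarrow> F z = q z" "z \<in> \<D>"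
  shows "remove_sings F z = q z"
proof (rule remove_sings_eqI)
  have "isCont q z"
    using assms(1,3) holomorphic_on_imp_continuous_on
      continuous_on_eq_continuous_at[OF open_ball] by blast
  then have lim: "q \<midarrow>z\<rightarrow> q z"
    by (simp add: isCont_def)
  have "eventually (\<lambda>x. x \<in> \<D>) (at z)"
    using assms(3) by (intro eventually_at_in_open') auto
  moreover have "eventually (\<lambda>x. x \<noteq> 0) (at z)"
    by (rule eventually_neq_at_within)
  ultimately have "eventually (\<lambda>x. F x = q x) (at z)"
    by eventually_elim (use assms(2) in auto)
  then show "F \<midarrow>z\<rightarrow> q z"
    using lim by (simp cong: filterlim_cong add: filterlim_cong[OF refl refl])
qed

text \<open>
  Off the origin the quotient is analytic, so filling in singularities does not change it; at the
  origin both sides vanish, whatever value is filled in.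
\<close>

lemma eq_mult_remove_sings_quotient:
  assumes f: "f holomorphic_on \<D>" "f 0 = 0" and g: "g holomorphic_on \<D>" "g 0 = 0"
    and ne: "\<And>z. z \<in> \<D> \<Longrightarrow> z \<noteq> 0 \<Longrightarrow> g z \<noteq> 0" and z: "z \<in> \<D>"
  shows "f z = g z * remove_sings (\<lambda>z. f z / g z) z"
proof (cases "z = 0")
  case False
  have "(\<lambda>z. f z / g z) holomorphic_on \<D> - {0}"
    using f g ne by (intro holomorphic_intros) (auto intro: holomorphic_on_subset)
  then have "(\<lambda>z. f z / g z) analytic_on \<D> - {0}"
    by (simp add: analytic_on_open open_delete)
  then have "(\<lambda>z. f z / g z) analytic_on {z}"
    using z False by (rule_tac analytic_on_subset) auto
  then show ?thesis
    using ne[OF z False] by simp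
qed (use f g in simp)

lemma remove_sings_quotient_eq:
  assumes "q holomorphic_on \<D>" "\<And>z. z \<in> \<D> \<Longrightarrow> f z = g z * q z"
    and "\<And>z. z \<in> \<D> \<Longrightarrow> z \<noteq> 0 \<Longrightarrow> g z \<noteq> 0" "z \<in> \<D>"
  shows "remove_sings (\<lambda>z. f z / g z) z = q z"
  using assms by (intro remove_sings_eq_off_0) auto

lemma class_P_cong: "p \<in> \<P> \<Longrightarrow> (\<And>z. z \<in> \<D> \<Longrightarrow> q z = p z) \<Longrightarrow> q \<in> \<P>"
  by (auto simp: class_P_def intro: holomorphic_transform[of p])

lemma class_P_half_cong:
  "p \<in> \<P>\<^bsub>1/2\<^esub> \<Longrightarrow> (\<And>z. z \<in> \<D> \<Longrightarrow> q z = p z) \<Longrightarrow> q \<in> \<P>\<^bsub>1/2\<^esub>"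
  by (auto simp: class_P_half_def intro: class_P_cong)

lemma class_A_ident_mult:
  assumes h: "nonvanishing h" and f: "\<And>z. z \<in> \<D> \<Longrightarrow> f z = z * h z"
  shows "f \<in> \<A>"
proof -
  have hol: "h holomorphic_on \<D>" and h0: "h 0 = 1"
    using h by (auto simp: nonvanishing_def)
  have "(\<lambda>z. z * h z) holomorphic_on \<D>"
    by (intro holomorphic_intros hol)
  then have "f holomorphic_on \<D>"
    using f by (rule_tac holomorphic_transform) auto
  moreover have "deriv f 0 = 1"
  proof (rule DERIV_imp_deriv)
    have "((\<lambda>z. z * h z) has_field_derivative 1) (at 0)"
      by (rule derivative_eq_intros holomorphic_derivI[OF hol open_ball] refl | simp add: h0)+
    then show "(f has_field_derivative 1) (at 0)"
      by (rule has_field_derivative_transform_within_open[where S = \<D>]) (auto simp: f)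
  qed
  ultimately show ?thesis
    using f[of 0] by (simp add: class_A_def)
qed

lemma product_if_remove_sings_quotient:
  assumes "f \<in> \<A>" "p \<in> \<P>" "z \<in> \<D>"
  shows "f z = z * (p z * remove_sings (\<lambda>z. f z / (z * p z)) z)"
proof -
  have "f z = (z * p z) * remove_sings (\<lambda>z. f z / (z * p z)) z"
    using assms nonvanishing_class_P[of p]
    by (intro eq_mult_remove_sings_quotient)
       (auto simp: class_A_def nonvanishing_def intro!: holomorphic_intros)
  then show ?thesis
    by (simp add: mult.assoc)
qed

lemma product_if_remove_sings_quotients:
  assumes fg: "f \<in> \<A>" "g \<in> \<A>" and pq: "p \<in> \<P>" "q \<in> \<P>"
    and q: "q = remove_sings (\<lambda>z. g z / (z * p z))" and z: "z \<in> \<D>"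
  shows "f z = z * (p z * q z * remove_sings (\<lambda>z. f z / g z) z)"
proof -
  have g: "g z = z * (p z * q z)" if "z \<in> \<D>" for z
    using product_if_remove_sings_quotient[OF fg(2) pq(1) that] q by simp
  have "f z = g z * remove_sings (\<lambda>z. f z / g z) z"
  proof (rule eq_mult_remove_sings_quotient)
    show "g z \<noteq> 0" if "z \<in> \<D>" "z \<noteq> 0" for z
      using g[OF that(1)] that pq nonvanishing_class_P by (simp add: nonvanishing_def)
  qed (use fg z in \<open>auto simp: class_A_def\<close>)
  then show ?thesis
    using g[OF z] by (simp add: mult.assoc)
qed

lemma class_G3_iff:
  "f \<in> \<G>\<^sub>3 \<longleftrightarrow> (\<exists>p\<in>\<P>. \<exists>q\<in>\<P>. \<forall>z\<in>\<D>. f z = z * (p z * q z))"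
proof
  assume "f \<in> \<G>\<^sub>3"
  then show "\<exists>p\<in>\<P>. \<exists>q\<in>\<P>. \<forall>z\<in>\<D>. f z = z * (p z * q z)"
    unfolding class_G3_def using product_if_remove_sings_quotient by blast
next
  assume "\<exists>p\<in>\<P>. \<exists>q\<in>\<P>. \<forall>z\<in>\<D>. f z = z * (p z * q z)"
  then obtain p q where pq: "p \<in> \<P>" "q \<in> \<P>" and f: "\<And>z. z \<in> \<D> \<Longrightarrow> f z = z * (p z * q z)"
    by blast
  have nv: "nonvanishing p" "nonvanishing q"
    using pq by (auto intro: nonvanishing_class_P)
  have "remove_sings (\<lambda>z. f z / (z * p z)) \<in> \<P>"
    using nv f
    by (intro class_P_cong[OF pq(2)] remove_sings_quotient_eq) (auto simp: nonvanishing_def)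
  with pq show "f \<in> \<G>\<^sub>3"
    using class_A_ident_mult[OF nonvanishing_mult[OF nv] f] by (auto simp: class_G3_def)
qed

text \<open>
  The witness for the intermediate function is \<open>g z = z * (p z * q z)\<close>. The last conclusion is an
  equality and not membership in a class, so that it serves \<open>\<G>\<^sub>1\<close> and \<open>\<G>\<^sub>2\<close> alike.
\<close>

lemma quotients_if_product:
  assumes p: "p \<in> \<P>" and q: "q \<in> \<P>" and s: "s \<in> \<P>"
    and f: "\<And>z. z \<in> \<D> \<Longrightarrow> f z = z * (p z * q z * s z)"
  obtains g where "f \<in> \<A>" "g \<in> \<A>" "remove_sings (\<lambda>z. f z / g z) \<in> \<P>"
    "\<forall>z\<in>\<D>. remove_sings (\<lambda>z. g z / (z * p z)) z = q z"
proof
  let ?g = "\<lambda>z. z * (p z * q z)"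
  have nv: "nonvanishing p" "nonvanishing q" "nonvanishing s"
    using assms by (auto intro: nonvanishing_class_P)
  show "f \<in> \<A>"
    using nv f by (intro class_A_ident_mult[of "\<lambda>z. p z * q z * s z"] nonvanishing_mult) auto
  show "?g \<in> \<A>"
    using nv by (intro class_A_ident_mult[of "\<lambda>z. p z * q z"] nonvanishing_mult) auto
  show "remove_sings (\<lambda>z. f z / ?g z) \<in> \<P>"
    using nv f
    by (intro class_P_cong[OF s] remove_sings_quotient_eq) (auto simp: nonvanishing_def)
  show "\<forall>z\<in>\<D>. remove_sings (\<lambda>z. ?g z / (z * p z)) z = q z"
    using nv by (intro ballI remove_sings_quotient_eq) (auto simp: nonvanishing_def)
qed

lemma class_G1_iff:
  "f \<in> \<G>\<^sub>1 \<longleftrightarrow> (\<exists>p\<in>\<P>. \<exists>q\<in>\<P>. \<exists>s\<in>\<P>. \<forall>z\<in>\<D>. f z = z * (p z * q z * s z))"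
proof
  assume "f \<in> \<G>\<^sub>1"
  then show "\<exists>p\<in>\<P>. \<exists>q\<in>\<P>. \<exists>s\<in>\<P>. \<forall>z\<in>\<D>. f z = z * (p z * q z * s z)"
    unfolding class_G1_def using product_if_remove_sings_quotients[OF _ _ _ _ refl] by blast
next
  assume "\<exists>p\<in>\<P>. \<exists>q\<in>\<P>. \<exists>s\<in>\<P>. \<forall>z\<in>\<D>. f z = z * (p z * q z * s z)"
  then obtain p q s where *: "p \<in> \<P>" "q \<in> \<P>" "s \<in> \<P>"
    and f: "\<And>z. z \<in> \<D> \<Longrightarrow> f z = z * (p z * q z * s z)"
    by blast
  obtain g where g: "f \<in> \<A>" "g \<in> \<A>" "remove_sings (\<lambda>z. f z / g z) \<in> \<P>"
    and gq: "\<forall>z\<in>\<D>. remove_sings (\<lambda>z. g z / (z * p z)) z = q z"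
    using quotients_if_product[OF * f] by blast
  have "remove_sings (\<lambda>z. g z / (z * p z)) \<in> \<P>"
    using gq by (intro class_P_cong[OF *(2)]) blast
  with g *(1) show "f \<in> \<G>\<^sub>1"
    by (auto simp: class_G1_def)
qed

lemma class_G2_iff:
  "f \<in> \<G>\<^sub>2 \<longleftrightarrow> (\<exists>p\<in>\<P>. \<exists>q\<in>\<P>\<^bsub>1/2\<^esub>. \<exists>s\<in>\<P>. \<forall>z\<in>\<D>. f z = z * (p z * q z * s z))"
proof
  assume "f \<in> \<G>\<^sub>2"
  then show "\<exists>p\<in>\<P>. \<exists>q\<in>\<P>\<^bsub>1/2\<^esub>. \<exists>s\<in>\<P>. \<forall>z\<in>\<D>. f z = z * (p z * q z * s z)"
    unfolding class_G2_def
    using product_if_remove_sings_quotients[OF _ _ _ _ refl] class_P_half_subset by blast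
next
  assume "\<exists>p\<in>\<P>. \<exists>q\<in>\<P>\<^bsub>1/2\<^esub>. \<exists>s\<in>\<P>. \<forall>z\<in>\<D>. f z = z * (p z * q z * s z)"
  then obtain p q s where *: "p \<in> \<P>" "q \<in> \<P>\<^bsub>1/2\<^esub>" "s \<in> \<P>"
    and f: "\<And>z. z \<in> \<D> \<Longrightarrow> f z = z * (p z * q z * s z)"
    by blast
  obtain g where g: "f \<in> \<A>" "g \<in> \<A>" "remove_sings (\<lambda>z. f z / g z) \<in> \<P>"
    and gq: "\<forall>z\<in>\<D>. remove_sings (\<lambda>z. g z / (z * p z)) z = q z"
    using quotients_if_product[OF *(1) class_P_half_subset[OF *(2)] *(3) f] by blast
  have "remove_sings (\<lambda>z. g z / (z * p z)) \<in> \<P>\<^bsub>1/2\<^esub>"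
    using gq by (intro class_P_half_cong[OF *(2)]) blast
  with g *(1) show "f \<in> \<G>\<^sub>2"
    by (auto simp: class_G2_def)
qed

section \<open>The nephroid domain\<close>

text \<open>
  An open map that sends the unit circle to points at distance at least \<open>2 / 3\<close> from the image of
  the origin covers the whole disc of that radius.
\<close>

lemma ball_subset_nephroid: "ball 1 (2 / 3) \<subseteq> nephroid ` \<D>"
proof -
  have "ball (nephroid 0) (2 / 3) \<subseteq> nephroid ` \<D>"
  proof (rule ball_subset_open_map_image)
    show "continuous_on (closure \<D>) nephroid"
      unfolding nephroid_def by (intro continuous_intros) auto
    show "open (nephroid ` interior \<D>)"
      using open_mapping_thm3[OF nephroid_admissible(1) open_ball nephroid_admissible(2)] by simp
    show "2 / 3 \<le> norm (nephroid z - nephroid 0)" if "z \<in> frontier \<D>" for z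
    proof -
      have z: "norm z = 1"
        using that by simp
      have "norm z - norm (z ^ 3 / 3) \<le> norm (z - z ^ 3 / 3)"
        by (rule norm_triangle_ineq2)
      then show ?thesis
        using z by (simp add: nephroid_def norm_divide norm_power)
    qed
  qed auto
  then show ?thesis
    by (simp add: nephroid_admissible)
qed

text \<open>
  The value \<open>5 / 3\<close> is attained at \<open>1\<close> to second order, which leaves \<open>-2\<close> as the third solution of
  the cubic equation.
\<close>

lemma nephroid_neq_5_3: "z \<in> \<D> \<Longrightarrow> nephroid z \<noteq> 5 / 3"
proof
  assume z: "z \<in> \<D>" and "nephroid z = 5 / 3"
  have "(z - 1)\<^sup>2 * (z + 2) = 5 - 3 * nephroid z"
    by (simp add: nephroid_def power2_eq_square power3_eq_cube algebra_simps)
  then have "(z - 1)\<^sup>2 * (z + 2) = 0"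
    unfolding \<open>nephroid z = 5 / 3\<close> by simp
  then have "z = 1 \<or> z = -2"
    by (auto simp: add_eq_0_iff2)
  then show False
    using z by auto
qed

text \<open>
  Univalence of \<open>nephroid\<close> supplies the self-map: it is \<open>F\<close> followed by the holomorphic inverse of
  \<open>nephroid\<close>.
\<close>

lemma subordinate_nephroid_if_near_1:
  assumes hol: "F holomorphic_on \<D>" and F0: "F 0 = 1"
    and near: "\<And>z. z \<in> \<D> \<Longrightarrow> norm (F z - 1) < 2 / 3"
  shows "F \<prec> nephroid"
proof -
  obtain g where g: "g holomorphic_on (nephroid ` \<D>)"
    and inv: "\<And>z. z \<in> \<D> \<Longrightarrow> g (nephroid z) = z"
    using holomorphic_has_inverse[OF nephroid_admissible(1) open_ball nephroid_admissible(2)]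
    by metis
  have F: "F ` \<D> \<subseteq> nephroid ` \<D>"
    using near ball_subset_nephroid by (force simp: dist_norm norm_minus_commute)
  have right: "nephroid (g (F z)) = F z" "g (F z) \<in> \<D>" if "z \<in> \<D>" for z
    using F that inv by force+
  have "g \<circ> F holomorphic_on \<D>"
    using hol g F by (rule holomorphic_on_compose_gen)
  moreover have "(g \<circ> F) 0 = 0"
    using inv[of 0] by (simp add: F0 nephroid_admissible)
  ultimately show ?thesis
    unfolding subordinate_def using right hol nephroid_admissible(1)
    by (intro conjI exI[of _ "g \<circ> F"]) auto
qed

section \<open>A criterion for the nephroid radius\<close>

lemma subordinate_cong:
  fixes F G \<phi> :: "complex \<Rightarrow> complex"
  assumes "\<And>z. z \<in> \<D> \<Longrightarrow> F z = G z"
  shows "F \<prec> \<phi> \<longleftrightarrow> G \<prec> \<phi>"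
proof -
  have "F holomorphic_on \<D> \<longleftrightarrow> G holomorphic_on \<D>"
    by (rule holomorphic_cong[OF refl assms])
  moreover have "(\<forall>z\<in>\<D>. F z = \<phi> (w z)) \<longleftrightarrow> (\<forall>z\<in>\<D>. G z = \<phi> (w z))" for w
    using assms by simp
  ultimately show ?thesis
    unfolding subordinate_def by blast
qed

lemma dilation_in_disc:
  assumes "0 < r" "r < 1" "z \<in> \<D>"
  shows "complex_of_real r * z \<in> \<D>"
  using assms mult_strict_mono'[of r 1 "norm z" 1] by (simp add: norm_mult)

lemma holomorphic_on_dilation:
  assumes "0 < r" "r < 1" "G holomorphic_on \<D>"
  shows "(\<lambda>z. G (complex_of_real r * z)) holomorphic_on \<D>"
proof -
  have lin: "(\<lambda>z. complex_of_real r * z) holomorphic_on \<D>"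
    by (intro holomorphic_intros)
  have "(\<lambda>z. complex_of_real r * z) ` \<D> \<subseteq> \<D>"
    using dilation_in_disc[OF assms(1,2)] by blast
  from holomorphic_on_compose_gen[OF lin assms(3) this] show ?thesis
    by (simp add: o_def)
qed

lemma holomorphic_on_log_rate: "nonvanishing h \<Longrightarrow> log_rate h holomorphic_on \<D>"
  unfolding log_rate_def by (intro holomorphic_intros) (auto simp: nonvanishing_def)

lemma dilation_starlike_Ne_iff:
  assumes h: "nonvanishing h" and f: "\<And>z. z \<in> \<D> \<Longrightarrow> f z = z * h z" and r: "0 < r" "r < 1"
  shows "(\<lambda>z. inverse (complex_of_real r) * f (complex_of_real r * z)) \<in> \<S>\<^sup>*\<^sub>N\<^sub>e \<longleftrightarrow>
    (\<lambda>z. 1 + log_rate h (complex_of_real r * z)) \<prec> nephroid"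
proof -
  let ?k = "\<lambda>z. inverse (complex_of_real r) * f (complex_of_real r * z)"
  let ?F = "\<lambda>z. 1 + log_rate h (complex_of_real r * z)"
  have hol: "h holomorphic_on \<D>" and h0: "\<And>z. z \<in> \<D> \<Longrightarrow> h z \<noteq> 0"
    using h by (auto simp: nonvanishing_def)
  note rz = dilation_in_disc[OF r] and comp = holomorphic_on_dilation[OF r]
  have nv: "nonvanishing (\<lambda>z. h (complex_of_real r * z))"
    using h comp rz by (auto simp: nonvanishing_def)
  have kA: "?k \<in> \<A>"
    using r f rz by (intro class_A_ident_mult[OF nv]) (simp add: field_simps)
  have holF: "?F holomorphic_on \<D>"
    using h by (intro holomorphic_intros comp holomorphic_on_log_rate)
  have eq: "z * deriv ?k z / ?k z = ?F z" if z: "z \<in> \<D>" "z \<noteq> 0" for z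
  proof -
    define u where "u = complex_of_real r * z"
    have u: "u \<in> \<D>" "u \<noteq> 0"
      using rz z r by (auto simp: u_def)
    have "((\<lambda>z. z * h z) has_field_derivative h u + u * deriv h u) (at u)"
      by (rule derivative_eq_intros holomorphic_derivI[OF hol open_ball u(1)] refl | simp)+
    then have "(f has_field_derivative h u + u * deriv h u) (at u)"
      by (rule has_field_derivative_transform_within_open[where S = \<D>]) (use u f in auto)
    then have "(?k has_field_derivative h u + u * deriv h u) (at z)"
      unfolding u_def using r
      by (auto intro!: derivative_eq_intros DERIV_chain2[of f])
    then have "deriv ?k z = h u + u * deriv h u"
      by (rule DERIV_imp_deriv)
    moreover have "?k z = z * h u"
      using f[OF u(1)] r by (simp add: u_def field_simps)
    ultimately show ?thesis
      using z h0[OF u(1)] u r unfolding u_def[symmetric] log_rate_def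
      by (simp add: field_simps)
  qed
  have "remove_sings (\<lambda>z. z * deriv ?k z / ?k z) z = ?F z" if "z \<in> \<D>" for z
    using eq that by (intro remove_sings_eq_off_0[OF holF])
  then have "remove_sings (\<lambda>z. z * deriv ?k z / ?k z) \<prec> nephroid \<longleftrightarrow> ?F \<prec> nephroid"
    by (rule subordinate_cong)
  then show ?thesis
    using kA by (simp add: starlike_Ne_def starlike_class_def)
qed

text \<open>
  The number \<open>2 / 3\<close> plays two roles. If \<open>\<bar>log_rate h\<bar> < 2 / 3\<close>, then \<open>z f' / f\<close> stays in the largest
  disc about \<open>1\<close> inside the nephroid domain. If \<open>log_rate h\<close> takes the value \<open>2 / 3\<close> itself, then
  \<open>z f' / f\<close> takes the value \<open>5 / 3\<close>, where the boundary of the domain touches that disc.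
\<close>

lemma is_radius_starlike_Ne:
  assumes R: "0 < R" "R < 1"
    and bound: "\<And>f. f \<in> F \<Longrightarrow> \<exists>h. nonvanishing h \<and> (\<forall>z\<in>\<D>. f z = z * h z) \<and>
      (\<forall>z. norm z < R \<longrightarrow> norm (log_rate h z) < 2 / 3)"
    and h0: "nonvanishing h\<^sub>0" "(\<lambda>z. z * h\<^sub>0 z) \<in> F" "log_rate h\<^sub>0 (complex_of_real R) = 2 / 3"
  shows "is_radius \<S>\<^sup>*\<^sub>N\<^sub>e F R"
  unfolding is_radius_def
proof (intro conjI allI impI)
  show "has_radius_property \<S>\<^sup>*\<^sub>N\<^sub>e F R"
    unfolding has_radius_property_def
  proof (intro conjI ballI allI impI)
    fix f and r :: real
    assume "f \<in> F" and "0 < r \<and> r < R"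
    then have r: "0 < r" "r < R"
      by auto
    obtain h where h: "nonvanishing h" and f: "\<And>z. z \<in> \<D> \<Longrightarrow> f z = z * h z"
      and less: "\<And>z. norm z < R \<Longrightarrow> norm (log_rate h z) < 2 / 3"
      using bound[OF \<open>f \<in> F\<close>] by blast
    have rz: "norm (complex_of_real r * z) < R" if "z \<in> \<D>" for z
    proof -
      have "norm (complex_of_real r * z) = r * norm z"
        using r by (simp add: norm_mult)
      also have "\<dots> \<le> r"
        using that r by (simp add: mult_left_le)
      finally show ?thesis
        using r by simp
    qed
    have "(\<lambda>z. log_rate h (complex_of_real r * z)) holomorphic_on \<D>"
      using h r R by (intro holomorphic_on_dilation holomorphic_on_log_rate) auto
    then have "(\<lambda>z. 1 + log_rate h (complex_of_real r * z)) \<prec> nephroid"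
      using less rz
      by (intro subordinate_nephroid_if_near_1) (auto intro: holomorphic_intros simp: log_rate_def)
    then show "(\<lambda>z. inverse (complex_of_real r) * f (complex_of_real r * z)) \<in> \<S>\<^sup>*\<^sub>N\<^sub>e"
      using dilation_starlike_Ne_iff[OF h f] r R by simp
  qed (use R in auto)
next
  fix R'
  assume R': "has_radius_property \<S>\<^sup>*\<^sub>N\<^sub>e F R'"
  show "R' \<le> R"
  proof (rule ccontr)
    assume "\<not> R' \<le> R"
    \<comment> \<open>The dilation by \<open>r\<close> brings the critical point \<open>R\<close> into the open disc, as \<open>R / r\<close>.\<close>
    define r where "r = (R + R') / 2"
    have r: "0 < r" "r < 1" "r < R'" "R < r"
      using \<open>\<not> R' \<le> R\<close> R R' by (auto simp: r_def has_radius_property_def)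
    define f where "f = (\<lambda>z. z * h\<^sub>0 z)"
    have "f \<in> F"
      using h0(2) by (simp add: f_def)
    then have "(\<lambda>z. inverse (complex_of_real r) * f (complex_of_real r * z)) \<in> \<S>\<^sup>*\<^sub>N\<^sub>e"
      using R' r unfolding has_radius_property_def by blast
    then have "(\<lambda>z. 1 + log_rate h\<^sub>0 (complex_of_real r * z)) \<prec> nephroid"
      using dilation_starlike_Ne_iff[OF h0(1) _ r(1,2), of f] by (simp add: f_def)
    then obtain w where w: "w ` \<D> \<subseteq> \<D>"
      and eq: "\<And>z. z \<in> \<D> \<Longrightarrow> 1 + log_rate h\<^sub>0 (complex_of_real r * z) = nephroid (w z)"
      unfolding subordinate_def by blast
    define z where "z = complex_of_real (R / r)"
    have z: "z \<in> \<D>"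
      using r R by (simp add: z_def norm_divide)
    have "complex_of_real r * z = complex_of_real R"
      using r by (simp add: z_def)
    then have "nephroid (w z) = 5 / 3"
      using eq[OF z] h0(3) by simp
    moreover have "w z \<in> \<D>"
      using w z by blast
    ultimately show False
      using nephroid_neq_5_3 by blast
  qed
qed

section \<open>Extremal functions and the three radii\<close>

text \<open>
  The functions \<open>cayley\<close> and \<open>half_kernel\<close> attain the bounds on \<open>\<bar>log_rate\<bar>\<close> for \<open>\<P>\<close> and for real
  part above \<open>1 / 2\<close> at every point of the interval \<open>(0, 1)\<close>, so that products of them are extremal.
\<close>
definition cayley :: "complex \<Rightarrow> complex"
  where "cayley z = (1 + z) / (1 - z)"

definition half_kernel :: "complex \<Rightarrow> complex"
  where "half_kernel z = 1 / (1 - z)"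


lemma half_kernel_class_P_half: "half_kernel \<in> \<P>\<^bsub>1/2\<^esub>"
proof -
  have half: "1 / 2 < Re (half_kernel z)" if "z \<in> \<D>" for z
  proof -
    have "(norm z)\<^sup>2 < 1"
      using that by (simp add: abs_square_less_1)
    then have "(Re z)\<^sup>2 + (Im z)\<^sup>2 < 1"
      by (simp add: cmod_power2)
    moreover have "1 - z \<noteq> 0"
      using that by auto
    then have "0 < (1 - Re z)\<^sup>2 + (Im z)\<^sup>2"
      by (auto simp: complex_eq_iff sum_power2_gt_zero_iff)
    ultimately show ?thesis
      by (simp add: half_kernel_def Re_divide field_simps) (simp add: power2_eq_square algebra_simps)
  qed
  moreover have "half_kernel holomorphic_on \<D>"
    unfolding half_kernel_def by (intro holomorphic_intros) auto
  moreover have "0 < Re (half_kernel z)" if "z \<in> \<D>" for z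
    using half[OF that] by simp
  ultimately show ?thesis
    by (auto simp: class_P_half_def class_P_def half_kernel_def)
qed

lemma cayley_class_P: "cayley \<in> \<P>"
proof -
  have eq: "cayley z = 2 * half_kernel z - 1" if "z \<in> \<D>" for z
  proof -
    have "1 - z \<noteq> 0"
      using that by auto
    then show ?thesis
      by (simp add: cayley_def half_kernel_def field_simps)
  qed
  have "cayley holomorphic_on \<D>"
    unfolding cayley_def by (intro holomorphic_intros) auto
  moreover have "0 < Re (cayley z)" if "z \<in> \<D>" for z
  proof -
    have "1 / 2 < Re (half_kernel z)"
      using half_kernel_class_P_half that unfolding class_P_half_def by blast
    then show ?thesis
      using that by (simp add: eq)
  qed
  ultimately show ?thesis
    by (simp add: class_P_def cayley_def)
qed

lemma log_rate_cayley:
  assumes "z \<in> \<D>"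
  shows "log_rate cayley z = 2 * z / (1 - z\<^sup>2)"
proof -
  have ne: "1 - z \<noteq> 0" "1 + z \<noteq> 0"
    using assms by (auto simp: add_eq_0_iff)
  have "(cayley has_field_derivative 2 / (1 - z)\<^sup>2) (at z)"
    unfolding cayley_def[abs_def]
    by (rule derivative_eq_intros refl ne | simp)+
       (simp add: power2_eq_square algebra_simps)
  then have "deriv cayley z = 2 / (1 - z)\<^sup>2"
    by (rule DERIV_imp_deriv)
  moreover have "1 - z\<^sup>2 = (1 - z) * (1 + z)"
    by (simp add: power2_eq_square algebra_simps)
  ultimately show ?thesis
    using ne by (simp add: log_rate_def cayley_def power2_eq_square)
qed

lemma log_rate_half_kernel:
  assumes "z \<in> \<D>"
  shows "log_rate half_kernel z = z / (1 - z)"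
proof -
  have ne: "1 - z \<noteq> 0"
    using assms by auto
  have "(half_kernel has_field_derivative 1 / (1 - z)\<^sup>2) (at z)"
    unfolding half_kernel_def[abs_def]
    by (rule derivative_eq_intros refl ne | simp)+
       (simp add: power2_eq_square)
  then have "deriv half_kernel z = 1 / (1 - z)\<^sup>2"
    by (rule DERIV_imp_deriv)
  then show ?thesis
    using ne by (simp add: log_rate_def half_kernel_def power2_eq_square)
qed

lemma is_radius_G3: "is_radius \<S>\<^sup>*\<^sub>N\<^sub>e \<G>\<^sub>3 (sqrt 10 - 3)"
proof -
  define R where "R = sqrt 10 - 3"
  have R: "0 < R" "R < 1"
  proof -
    have "3 < sqrt 10" "sqrt 10 < 4"
      by (rule real_less_rsqrt, simp) (rule real_less_lsqrt, simp_all)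
    then show "0 < R" "R < 1"
      by (simp_all add: R_def)
  qed
  have root: "6 * R = 1 - R\<^sup>2"
    by (simp add: R_def power2_eq_square algebra_simps)
  have "is_radius \<S>\<^sup>*\<^sub>N\<^sub>e \<G>\<^sub>3 R"
  proof (rule is_radius_starlike_Ne[OF R])
    fix f
    assume "f \<in> \<G>\<^sub>3"
    then obtain p q where pq: "p \<in> \<P>" "q \<in> \<P>" and f: "\<forall>z\<in>\<D>. f z = z * (p z * q z)"
      unfolding class_G3_iff by blast
    note nv = pq[THEN nonvanishing_class_P]
    have "norm (log_rate (\<lambda>z. p z * q z) z) < 2 / 3" if z: "norm z < R" for z
    proof -
      have zD: "z \<in> \<D>"
        using z R by simp
      have sq: "(norm z)\<^sup>2 < R\<^sup>2"
        using z by (intro power_strict_mono) auto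
      have pos: "0 < 1 - (norm z)\<^sup>2"
        using zD by (simp add: abs_square_less_1)
      have "norm (log_rate (\<lambda>z. p z * q z) z) \<le> norm (log_rate p z) + norm (log_rate q z)"
        unfolding log_rate_mult[OF nv zD] by (rule norm_triangle_ineq)
      also have "\<dots> \<le> 4 * norm z / (1 - (norm z)\<^sup>2)"
        using add_mono[OF pq[THEN norm_log_rate_class_P, OF zD]]
        by (simp flip: add_divide_distrib)
      also have "\<dots> < 2 / 3"
        using pos sq z root by (simp add: field_simps)
      finally show ?thesis .
    qed
    then show "\<exists>h. nonvanishing h \<and> (\<forall>z\<in>\<D>. f z = z * h z) \<and>
        (\<forall>z. norm z < R \<longrightarrow> norm (log_rate h z) < 2 / 3)"
      using nonvanishing_mult[OF nv] f by blast
  next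
    note nv = cayley_class_P[THEN nonvanishing_class_P]
    show "nonvanishing (\<lambda>z. cayley z * cayley z)"
      by (rule nonvanishing_mult[OF nv nv])
    show "(\<lambda>z. z * (cayley z * cayley z)) \<in> \<G>\<^sub>3"
      unfolding class_G3_iff using cayley_class_P by blast
    have "log_rate (\<lambda>z. cayley z * cayley z) (complex_of_real R) =
        complex_of_real (4 * R / (1 - R\<^sup>2))"
      using R by (simp add: log_rate_mult[OF nv nv] log_rate_cayley)
    also have "4 * R / (1 - R\<^sup>2) = 2 / 3"
      using R by (simp flip: root)
    finally show "log_rate (\<lambda>z. cayley z * cayley z) (complex_of_real R) = 2 / 3"
      by simp
  qed
  then show ?thesis
    by (simp add: R_def)
qed

lemma is_radius_G1: "is_radius \<S>\<^sup>*\<^sub>N\<^sub>e \<G>\<^sub>1 ((sqrt 85 - 9) / 2)"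
proof -
  define R where "R = (sqrt 85 - 9) / 2"
  have R: "0 < R" "R < 1"
  proof -
    have "9 < sqrt 85" "sqrt 85 < 11"
      by (rule real_less_rsqrt, simp) (rule real_less_lsqrt, simp_all)
    then show "0 < R" "R < 1"
      by (simp_all add: R_def)
  qed
  have root: "9 * R = 1 - R\<^sup>2"
    by (simp add: R_def power2_eq_square field_simps)
  have "is_radius \<S>\<^sup>*\<^sub>N\<^sub>e \<G>\<^sub>1 R"
  proof (rule is_radius_starlike_Ne[OF R])
    fix f
    assume "f \<in> \<G>\<^sub>1"
    then obtain p q s where pqs: "p \<in> \<P>" "q \<in> \<P>" "s \<in> \<P>"
      and f: "\<forall>z\<in>\<D>. f z = z * (p z * q z * s z)"
      unfolding class_G1_iff by blast
    note nv = pqs[THEN nonvanishing_class_P]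
    note nv2 = nonvanishing_mult[OF nv(1,2)]
    have "norm (log_rate (\<lambda>z. p z * q z * s z) z) < 2 / 3" if z: "norm z < R" for z
    proof -
      have zD: "z \<in> \<D>"
        using z R by simp
      have sq: "(norm z)\<^sup>2 < R\<^sup>2"
        using z by (intro power_strict_mono) auto
      have pos: "0 < 1 - (norm z)\<^sup>2"
        using zD by (simp add: abs_square_less_1)
      have "norm (log_rate (\<lambda>z. p z * q z * s z) z) \<le>
          norm (log_rate p z) + norm (log_rate q z) + norm (log_rate s z)"
        unfolding log_rate_mult[OF nv2 nv(3) zD] log_rate_mult[OF nv(1,2) zD]
        by (intro norm_triangle_le add_mono norm_triangle_ineq order_refl)
      also have "\<dots> \<le> 6 * norm z / (1 - (norm z)\<^sup>2)"
        using add_mono[OF add_mono[OF pqs(1,2)[THEN norm_log_rate_class_P, OF zD]]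
            norm_log_rate_class_P[OF pqs(3) zD]]
        by (simp flip: add_divide_distrib)
      also have "\<dots> < 2 / 3"
        using pos sq z root by (simp add: field_simps)
      finally show ?thesis .
    qed
    then show "\<exists>h. nonvanishing h \<and> (\<forall>z\<in>\<D>. f z = z * h z) \<and>
        (\<forall>z. norm z < R \<longrightarrow> norm (log_rate h z) < 2 / 3)"
      using nonvanishing_mult[OF nv2 nv(3)] f by blast
  next
    note nv = cayley_class_P[THEN nonvanishing_class_P]
    note nv2 = nonvanishing_mult[OF nv nv]
    show "nonvanishing (\<lambda>z. cayley z * cayley z * cayley z)"
      by (rule nonvanishing_mult[OF nv2 nv])
    show "(\<lambda>z. z * (cayley z * cayley z * cayley z)) \<in> \<G>\<^sub>1"
      unfolding class_G1_iff using cayley_class_P by blast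
    have "log_rate (\<lambda>z. cayley z * cayley z * cayley z) (complex_of_real R) =
        complex_of_real (6 * R / (1 - R\<^sup>2))"
      using R by (simp add: log_rate_mult[OF nv2 nv] log_rate_mult[OF nv nv] log_rate_cayley)
    also have "6 * R / (1 - R\<^sup>2) = 2 / 3"
      using R by (simp flip: root)
    finally show "log_rate (\<lambda>z. cayley z * cayley z * cayley z) (complex_of_real R) = 2 / 3"
      by simp
  qed
  then show ?thesis
    by (simp add: R_def)
qed

lemma is_radius_G2: "is_radius \<S>\<^sup>*\<^sub>N\<^sub>e \<G>\<^sub>2 ((sqrt 265 - 15) / 10)"
proof -
  define R where "R = (sqrt 265 - 15) / 10"
  have R: "0 < R" "R < 1"
  proof -
    have "15 < sqrt 265" "sqrt 265 < 25"
      by (rule real_less_rsqrt, simp) (rule real_less_lsqrt, simp_all)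
    then show "0 < R" "R < 1"
      by (simp_all add: R_def)
  qed
  have root: "5 * R\<^sup>2 + 15 * R = 2"
    by (simp add: R_def power2_eq_square field_simps)
  have combine: "4 * t / (1 - t\<^sup>2) + t / (1 - t) = (5 * t + t\<^sup>2) / (1 - t\<^sup>2)"
    if "0 \<le> t" "t < 1" for t :: real
  proof -
    have "1 - t\<^sup>2 = (1 - t) * (1 + t)"
      by (simp add: power2_eq_square algebra_simps)
    then show ?thesis
      using that by (simp add: divide_simps) (simp add: power2_eq_square algebra_simps)
  qed
  have "is_radius \<S>\<^sup>*\<^sub>N\<^sub>e \<G>\<^sub>2 R"
  proof (rule is_radius_starlike_Ne[OF R])
    fix f
    assume "f \<in> \<G>\<^sub>2"
    then obtain p q s where p: "p \<in> \<P>" and q: "q \<in> \<P>\<^bsub>1/2\<^esub>" and s: "s \<in> \<P>"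
      and f: "\<forall>z\<in>\<D>. f z = z * (p z * q z * s z)"
      unfolding class_G2_iff by blast
    note nv = p[THEN nonvanishing_class_P] q[THEN class_P_half_subset, THEN nonvanishing_class_P]
      s[THEN nonvanishing_class_P]
    note nv2 = nonvanishing_mult[OF nv(1,2)]
    have "norm (log_rate (\<lambda>z. p z * q z * s z) z) < 2 / 3" if z: "norm z < R" for z
    proof -
      have zD: "z \<in> \<D>"
        using z R by simp
      have sq: "(norm z)\<^sup>2 < R\<^sup>2"
        using z by (intro power_strict_mono) auto
      have pos: "0 < 1 - (norm z)\<^sup>2"
        using zD by (simp add: abs_square_less_1)
      have "norm (log_rate (\<lambda>z. p z * q z * s z) z) \<le>
          norm (log_rate p z) + norm (log_rate q z) + norm (log_rate s z)"
        unfolding log_rate_mult[OF nv2 nv(3) zD] log_rate_mult[OF nv(1,2) zD]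
        by (intro norm_triangle_le add_mono norm_triangle_ineq order_refl)
      also have "\<dots> \<le> 4 * norm z / (1 - (norm z)\<^sup>2) + norm z / (1 - norm z)"
        using norm_log_rate_class_P[OF p zD] norm_log_rate_class_P_half[OF q zD]
          norm_log_rate_class_P[OF s zD]
        by simp
      also have "\<dots> = (5 * norm z + (norm z)\<^sup>2) / (1 - (norm z)\<^sup>2)"
        using zD by (intro combine) auto
      also have "\<dots> < 2 / 3"
        using pos sq z root by (simp add: field_simps)
      finally show ?thesis .
    qed
    then show "\<exists>h. nonvanishing h \<and> (\<forall>z\<in>\<D>. f z = z * h z) \<and>
        (\<forall>z. norm z < R \<longrightarrow> norm (log_rate h z) < 2 / 3)"
      using nonvanishing_mult[OF nv2 nv(3)] f by blast
  next
    note nv = cayley_class_P[THEN nonvanishing_class_P]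
      half_kernel_class_P_half[THEN class_P_half_subset, THEN nonvanishing_class_P]
    note nv2 = nonvanishing_mult[OF nv]
    show "nonvanishing (\<lambda>z. cayley z * half_kernel z * cayley z)"
      by (rule nonvanishing_mult[OF nv2 nv(1)])
    show "(\<lambda>z. z * (cayley z * half_kernel z * cayley z)) \<in> \<G>\<^sub>2"
      unfolding class_G2_iff using cayley_class_P half_kernel_class_P_half by blast
    have "log_rate (\<lambda>z. cayley z * half_kernel z * cayley z) (complex_of_real R) =
        complex_of_real (4 * R / (1 - R\<^sup>2) + R / (1 - R))"
      using R by (simp add: log_rate_mult[OF nv2 nv(1)] log_rate_mult[OF nv]
          log_rate_cayley log_rate_half_kernel)
    also have "4 * R / (1 - R\<^sup>2) + R / (1 - R) = (5 * R + R\<^sup>2) / (1 - R\<^sup>2)"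
      using R by (intro combine) auto
    also have "\<dots> = 2 / 3"
    proof -
      have "R\<^sup>2 < 1"
        using R by (simp add: abs_square_less_1)
      then show ?thesis
        using root by (simp add: field_simps)
    qed
    finally show "log_rate (\<lambda>z. cayley z * half_kernel z * cayley z) (complex_of_real R) = 2 / 3"
      by simp
  qed
  then show ?thesis
    by (simp add: R_def)
qed

theorem theorem3p10:
  "is_radius \<S>\<^sup>*\<^sub>N\<^sub>e \<G>\<^sub>1 ((sqrt 85 - 9) / 2) \<and>
   is_radius \<S>\<^sup>*\<^sub>N\<^sub>e \<G>\<^sub>2 ((sqrt 265 - 15) / 10) \<and>
   is_radius \<S>\<^sup>*\<^sub>N\<^sub>e \<G>\<^sub>3 (sqrt 10 - 3)"
  using is_radius_G1 is_radius_G2 is_radius_G3 by blast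

end
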